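(* For every positive integer $n$, the set of sizes of the orbits of the action of ${\rm Aut}(\Lambda_n)$ on $V(\Lambda_n)$ is \[ \{|X|;\ X \text{ a vertex orbit of } \Lambda_n\}\ =\ \{k \ge 1;\ k \mid n\} \cup \{k \ge 18;\ k \mid 2n\}. \]
   Context: A Lucas string of length $n$ is a binary string $u_1u_2\cdots u_n\in\{0,1\}^n$ with no two consecutive 1s and such that not both $u_1=1$ and $u_n=1$. The Lucas cube $\Lambda_n$ is the subgraph of the $n$-cube $Q_n$ (vertices: binary strings of length $n$, adjacent iff they differ in exactly one position) induced by the Lucas strings of length $n$. ${\rm Aut}(\Lambda_n)$ is its automorphism group, acting naturally on the vertex set $V(\Lambda_n)$; the vertex orbits are the orbits of this action. *)

theory Defs
  imports "Graph_Theory.Pair_Digraph" "Graph_Theory.Digraph_Component" "HOL-Algebra.Group_Action"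
begin

text \<open>Graphs are symmetric digraphs. A binary string is a list of booleans (\<open>True\<close> is the
  letter 1), indexed from 0.\<close>

definition hypercube :: "nat \<Rightarrow> bool list pair_pre_digraph" where
  "hypercube n =
    \<lparr>pverts = {u. length u = n},
     parcs = {(u, v). length u = n \<and> length v = n \<and> card {i. i < n \<and> u ! i \<noteq> v ! i} = 1}\<rparr>"

text \<open>For \<open>n = 1\<close> the first and the last letter coincide, so the string 1 is not a Lucas string.\<close>

definition lucas_string :: "nat \<Rightarrow> bool list \<Rightarrow> bool" where
  "lucas_string n u \<longleftrightarrow>
    length u = n \<and>
    (\<forall>i. Suc i < n \<longrightarrow> \<not> (u ! i \<and> u ! Suc i)) \<and>
    \<not> (0 < n \<and> u ! 0 \<and> u ! (n - 1))"

definition lucas_cube :: "nat \<Rightarrow> (bool list, bool list \<times> bool list) pre_digraph" where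
  "lucas_cube n = with_proj (hypercube n) \<restriction> {u. lucas_string n u}"

text \<open>For graphs without parallel arcs an automorphism is determined by its action on the
  vertices. As in \<^const>\<open>BijGroup\<close>, only functions that are extensional on the vertex set are taken,
  and the group operation is composition.\<close>

definition graph_aut :: "('a, 'b) pre_digraph \<Rightarrow> ('a \<Rightarrow> 'a) set" where
  "graph_aut G =
    {f \<in> Bij (verts G). \<forall>u\<in>verts G. \<forall>v\<in>verts G. u \<rightarrow>\<^bsub>G\<^esub> v \<longleftrightarrow> f u \<rightarrow>\<^bsub>G\<^esub> f v}"

definition graph_AutGroup :: "('a, 'b) pre_digraph \<Rightarrow> ('a \<Rightarrow> 'a) monoid" where
  "graph_AutGroup G = BijGroup (verts G)\<lparr>carrier := graph_aut G\<rparr>"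

lemma subgroup_graph_aut: "subgroup (graph_aut G) (BijGroup (verts G))"
proof (rule subgroup.intro)
  show "graph_aut G \<subseteq> carrier (BijGroup (verts G))"
    by (auto simp: graph_aut_def BijGroup_def)
next
  fix f g
  assume f: "f \<in> graph_aut G" and g: "g \<in> graph_aut G"
  then have B: "f \<in> Bij (verts G)" "g \<in> Bij (verts G)"
    by (auto simp: graph_aut_def)
  have "u \<rightarrow>\<^bsub>G\<^esub> v \<longleftrightarrow> f (g u) \<rightarrow>\<^bsub>G\<^esub> f (g v)" if "u \<in> verts G" "v \<in> verts G" for u v
  proof -
    have "g u \<in> verts G" "g v \<in> verts G"
      using that B(2) Bij_imp_funcset by fast+
    then show ?thesis
      using f g that unfolding graph_aut_def by blast
  qed
  then show "f \<otimes>\<^bsub>BijGroup (verts G)\<^esub> g \<in> graph_aut G"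
    using B by (simp add: graph_aut_def BijGroup_def compose_Bij compose_eq)
next
  show "\<one>\<^bsub>BijGroup (verts G)\<^esub> \<in> graph_aut G"
    by (simp add: graph_aut_def BijGroup_def id_Bij)
next
  fix f
  assume f: "f \<in> graph_aut G"
  then have fB: "f \<in> Bij (verts G)"
    by (simp add: graph_aut_def)
  have fi: "f (inv_into (verts G) f u) = u" if "u \<in> verts G" for u
    using fB that by (auto simp: Bij_def bij_betw_def f_inv_into_f)
  have "u \<rightarrow>\<^bsub>G\<^esub> v \<longleftrightarrow> inv_into (verts G) f u \<rightarrow>\<^bsub>G\<^esub> inv_into (verts G) f v"
    if "u \<in> verts G" "v \<in> verts G" for u v
    using f that fi Bij_inv_into_mem[OF fB] by (auto simp: graph_aut_def)
  then show "inv\<^bsub>BijGroup (verts G)\<^esub> f \<in> graph_aut G"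
    using fB by (simp add: graph_aut_def inv_BijGroup restrict_inv_into_Bij)
qed

text \<open>The natural action on the vertices is the inclusion into \<^const>\<open>BijGroup\<close>.\<close>

lemma graph_AutGroup_action: "group_action (graph_AutGroup G) (verts G) (\<lambda>f. f)"
proof -
  have "group (graph_AutGroup G)"
    unfolding graph_AutGroup_def
    by (rule subgroup.subgroup_is_group[OF subgroup_graph_aut group_BijGroup])
  moreover have "(\<lambda>f. f) \<in> hom (graph_AutGroup G) (BijGroup (verts G))"
    using subgroup.subset[OF subgroup_graph_aut] by (auto simp: hom_def graph_AutGroup_def)
  ultimately show ?thesis
    by (simp add: group_action_def group_hom_def group_hom_axioms_def group_BijGroup)
qed

definition vertex_orbits :: "('a, 'b) pre_digraph \<Rightarrow> 'a set set" where
  "vertex_orbits G = orbits (graph_AutGroup G) (verts G) (\<lambda>f. f)"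

end

theory Submission
  imports Defs "HOL-Number_Theory.Cong"
begin

text \<open>A Lucas string is an independent set of the cycle \<open>C\<^sub>n\<close>. Every automorphism of \<open>\<Lambda>\<^sub>n\<close> fixes the zero
  string, the only vertex of degree \<open>n\<close>, hence permutes the strings with a single 1. By induction on
  the number of ones this permutation determines the automorphism, and it preserves adjacency in
  \<open>C\<^sub>n\<close> because two positions carry a common Lucas string iff they are not adjacent. So the orbits are
  those of the dihedral group. If \<open>d\<close> is the least period of a string, its orbit has size
  \<open>d\<close> when some reflection maps the string to one of its rotations and \<open>2d\<close> otherwise; the second case
  requires cyclic gaps that do not read the same in both directions, and with all gaps at least 2
  the shortest such period is \<open>2 + 3 + 4 = 9\<close>.\<close>

section \<open>Automorphisms of simplicial complexes\<close>

text \<open>\<open>C\<close> arises from \<open>B - {a}\<close> by toggling some \<open>x\<close>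
  and from \<open>B - {b}\<close> by toggling some \<open>y\<close>. Comparing membership of
  \<open>a\<close> and \<open>b\<close> leaves only \<open>x = a\<close>, \<open>y = b\<close> or
  \<open>x = b\<close>, \<open>y = a\<close>. This is the fact that two vertices of a hypercube at
  distance 2 have exactly two common neighbours.\<close>

lemma common_neighbours_of_two_facets:
  assumes "a \<in> B" "b \<in> B" "a \<noteq> b"
    and "is_singleton (sym_diff C (B - {a}))" "is_singleton (sym_diff C (B - {b}))"
  shows "C = B \<or> C = B - {a, b}"
proof -
  obtain x where x: "sym_diff C (B - {a}) = {x}"
    using assms(4) unfolding is_singleton_def ..
  obtain y where y: "sym_diff C (B - {b}) = {y}"
    using assms(5) unfolding is_singleton_def ..
  have c: "c \<in> C \<longleftrightarrow> (c \<in> B \<and> c \<noteq> a) \<noteq> (c = x)" for c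
  proof -
    have "c \<in> sym_diff C (B - {a}) \<longleftrightarrow> c = x"
      by (simp only: x singleton_iff)
    then show ?thesis by blast
  qed
  have d: "c \<in> C \<longleftrightarrow> (c \<in> B \<and> c \<noteq> b) \<noteq> (c = y)" for c
  proof -
    have "c \<in> sym_diff C (B - {b}) \<longleftrightarrow> c = y"
      by (simp only: y singleton_iff)
    then show ?thesis by blast
  qed
  have "a \<in> C \<longleftrightarrow> a = x" "b \<in> C \<longleftrightarrow> b \<noteq> x" "a \<in> C \<longleftrightarrow> a \<noteq> y" "b \<in> C \<longleftrightarrow> b = y"
    using c[of a] d[of a] c[of b] d[of b] assms(1-3) by simp_all
  then have "x = a \<and> y = b \<or> x = b \<and> y = a"
    by blast
  then show ?thesis
  proof
    assume "x = a \<and> y = b"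
    then have "C = B"
      using c assms(1) by (intro Set.set_eqI) auto
    then show ?thesis ..
  next
    assume "x = b \<and> y = a"
    then have "C = B - {a, b}"
      using c assms(2,3) by (intro Set.set_eqI) auto
    then show ?thesis ..
  qed
qed

text \<open>The neighbours of \<open>{}\<close> are the singletons in \<open>V\<close>, so
  \<open>f\<close> permutes them, which defines \<open>\<sigma>\<close>. A set with at least two
  elements is then determined by the images of two of its facets, by induction along strict
  inclusion.\<close>

lemma simplicial_complex_automorphism:
  fixes V :: "'a set set"
  assumes fin: "\<And>A. A \<in> V \<Longrightarrow> finite A"
    and down: "\<And>A B. A \<in> V \<Longrightarrow> B \<subseteq> A \<Longrightarrow> B \<in> V"
    and bij: "bij_betw f V V"
    and adj: "\<And>A B. A \<in> V \<Longrightarrow> B \<in> V \<Longrightarrow>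
      is_singleton (sym_diff A B) \<longleftrightarrow> is_singleton (sym_diff (f A) (f B))"
    and f0: "f {} = {}"
  obtains \<sigma> where "bij_betw \<sigma> {x. {x} \<in> V} {x. {x} \<in> V}" "\<And>A. A \<in> V \<Longrightarrow> f A = \<sigma> ` A"
proof -
  define X where "X = {x. {x} \<in> V}"
  define \<sigma> where "\<sigma> x = the_elem (f {x})" for x
  have fV: "f A \<in> V" if "A \<in> V" for A
    using bij that by (auto simp: bij_betw_def)
  have inj: "A = B" if "f A = f B" "A \<in> V" "B \<in> V" for A B
    using bij that by (auto simp: bij_betw_def dest: inj_onD)
  \<comment> \<open>\<open>V\<close> may be empty, so membership of \<open>{}\<close> is derived
    from an existing vertex \<open>x\<close>.\<close>
  have emp: "{} \<in> V" if "x \<in> X" for x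
    using that down[of "{x}" "{}"] by (auto simp: X_def)
  have \<sigma>: "f {x} = {\<sigma> x}" if "x \<in> X" for x
  proof -
    have "is_singleton (sym_diff {} (f {x}))"
      using adj[of "{}" "{x}"] f0 emp[OF that] that by (simp add: X_def)
    then have "is_singleton (f {x})"
      by simp
    then show ?thesis
      by (simp add: \<sigma>_def is_singleton_the_elem)
  qed
  have \<sigma>X: "\<sigma> x \<in> X" if "x \<in> X" for x
    using \<sigma>[OF that] fV[of "{x}"] that by (simp add: X_def)
  have inj\<sigma>: "x = y" if "\<sigma> x = \<sigma> y" "x \<in> X" "y \<in> X" for x y
    using \<sigma>[OF that(2)] \<sigma>[OF that(3)] inj[of "{x}" "{y}"] that by (auto simp: X_def)
  have "X \<subseteq> \<sigma> ` X"
  proof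
    fix y assume y: "y \<in> X"
    then have "{y} \<in> f ` V"
      using bij by (simp add: bij_betw_def X_def)
    then obtain A where A: "A \<in> V" "f A = {y}"
      by (metis imageE)
    have "is_singleton (sym_diff {} A)"
      using adj[of "{}" A] emp[OF y] A f0 by simp
    then have "is_singleton A"
      by simp
    then obtain x where x: "A = {x}"
      by (rule is_singletonE)
    then have "x \<in> X"
      using A by (simp add: X_def)
    moreover have "y = \<sigma> x"
      using \<sigma>[OF \<open>x \<in> X\<close>] A x by simp
    ultimately show "y \<in> \<sigma> ` X"
      by blast
  qed
  then have "bij_betw \<sigma> X X"
    using inj\<sigma> \<sigma>X by (auto simp: bij_betw_def inj_on_def)
  moreover have "f A = \<sigma> ` A" if "A \<in> V" for A
    using fin[OF that] that
  proof (induction A rule: finite_psubset_induct)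
    case (psubset A)
    have IH: "f B = \<sigma> ` B" if "B \<subset> A" for B
      using psubset.IH[OF that] down[OF psubset.prems] that by blast
    have AX: "A \<subseteq> X"
      using down[OF psubset.prems] by (auto simp: X_def)
    consider "A = {}" | x where "A = {x}" | x y where "x \<in> A" "y \<in> A" "x \<noteq> y"
      by blast
    then show ?case
    proof cases
      case 1
      then show ?thesis by (simp add: f0)
    next
      case 2
      then show ?thesis using \<sigma> AX by simp
    next
      case 3
      have im: "\<sigma> ` (A - B) = \<sigma> ` A - \<sigma> ` B" if "B \<subseteq> A" for B
        using inj\<sigma> AX that by (intro inj_on_image_set_diff[of _ A]) (auto simp: inj_on_def)
      have facet: "is_singleton (sym_diff (f A) (\<sigma> ` A - {\<sigma> z}))" if "z \<in> A" for z
      proof -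
        have "sym_diff A (A - {z}) = {z}" "A - {z} \<subset> A"
          using that by auto
        then have "is_singleton (sym_diff (f A) (f (A - {z})))"
          using adj[of A "A - {z}"] down[OF psubset.prems, of "A - {z}"] psubset.prems by simp
        then show ?thesis
          using IH[OF \<open>A - {z} \<subset> A\<close>] im[of "{z}"] that by simp
      qed
      have "A - {x, y} \<subset> A"
        using 3 by blast
      txt \<open>By induction \<open>f A\<close> is adjacent to the images of two facets of \<open>A\<close>, which have only two common
        neighbours; injectivity of \<open>f\<close> excludes the lower one.\<close>
      have "f A = \<sigma> ` A \<or> f A = \<sigma> ` A - {\<sigma> x, \<sigma> y}"
        using 3 facet inj\<sigma> AX by (intro common_neighbours_of_two_facets facet) auto
      moreover have "f A \<noteq> f (A - {x, y})"
        using inj[of A "A - {x, y}"] down[OF psubset.prems, of "A - {x, y}"] psubset.prems 3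
        by auto
      moreover have "f (A - {x, y}) = \<sigma> ` A - {\<sigma> x, \<sigma> y}"
        using IH[OF \<open>A - {x, y} \<subset> A\<close>] im[of "{x, y}"] 3 by simp
      ultimately show ?thesis by auto
    qed
  qed
  ultimately show thesis
    using that unfolding X_def by blast
qed

section \<open>Independent sets of a cycle\<close>

text \<open>An injective walk around the cycle cannot turn back, because that would revisit the
  position of two steps earlier. Hence the direction \<open>s\<close> of the first step persists,
  and \<open>\<sigma>\<close> is affine with slope \<open>s\<close>.\<close>

lemma cycle_automorphism:
  fixes n :: nat
  assumes "0 < n" and inj: "inj_on \<sigma> {..<n}" and im: "\<And>i. i < n \<Longrightarrow> \<sigma> i < n"
    and adj: "\<And>i. i < n \<Longrightarrow>
      \<sigma> (Suc i mod n) = Suc (\<sigma> i) mod n \<or> \<sigma> i = Suc (\<sigma> (Suc i mod n)) mod n"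
  obtains s c :: int where "s \<in> {1, -1}" "\<And>i. i < n \<Longrightarrow> int (\<sigma> i) = (s * int i + c) mod int n"
proof -
  \<comment> \<open>The periodic extension of \<open>\<sigma>\<close> to all naturals lets the
    inductions run without a case for wrapping around.\<close>
  define g where "g k = int (\<sigma> (k mod n))" for k
  have step: "[g (Suc k) = g k + 1] (mod int n) \<or> [g (Suc k) = g k - 1] (mod int n)" for k
  proof -
    have "\<sigma> (Suc k mod n) = Suc (\<sigma> (k mod n)) mod n \<or> \<sigma> (k mod n) = Suc (\<sigma> (Suc k mod n)) mod n"
      using adj[of "k mod n"] \<open>0 < n\<close> by (simp add: mod_Suc_eq)
    then show ?thesis
    proof
      assume "\<sigma> (Suc k mod n) = Suc (\<sigma> (k mod n)) mod n"
      then have "g (Suc k) = (g k + 1) mod int n"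
        by (simp add: g_def zmod_int add.commute)
      then show ?thesis by (simp add: cong_def)
    next
      assume "\<sigma> (k mod n) = Suc (\<sigma> (Suc k mod n)) mod n"
      then have "g k = (g (Suc k) + 1) mod int n"
        by (simp add: g_def zmod_int add.commute)
      then have "[g k = g (Suc k) + 1] (mod int n)" by (simp add: cong_def)
      then have "[g k - 1 = g (Suc k) + 1 - 1] (mod int n)"
        by (intro cong_diff cong_refl)
      then show ?thesis by (simp add: cong_sym_eq)
    qed
  qed
  have g_inj: "[k = l] (mod n)" if "[g k = g l] (mod int n)" for k l
  proof -
    have "g k = g l"
      using that im[of "k mod n"] im[of "l mod n"] \<open>0 < n\<close> by (simp add: g_def cong_def)
    then show ?thesis
      using inj \<open>0 < n\<close> by (auto simp: g_def cong_def dest: inj_onD)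
  qed
  obtain s :: int where s: "s \<in> {1, -1}" "[g 1 = g 0 + s] (mod int n)"
    using step[of 0] that[of 1] that[of "- 1"] by fastforce
  have succ: "[g (Suc k) = g k + s] (mod int n)" for k
  proof (induction k)
    case 0
    show ?case using s by simp
  next
    case (Suc k)
    show ?case
    proof (rule ccontr)
      assume *: "\<not> ?thesis"
      then have "[g (Suc (Suc k)) = g (Suc k) - s] (mod int n)"
        using step[of "Suc k"] s(1) by auto
      moreover have "[g (Suc k) - s = g k + s - s] (mod int n)"
        by (intro cong_diff Suc.IH cong_refl)
      ultimately have "[g (Suc (Suc k)) = g k] (mod int n)"
        using cong_trans by fastforce
      then have "[Suc (Suc k) = k] (mod n)"
        by (rule g_inj)
      then have "[k + 2 = k + 0] (mod n)"
        by simp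
      then have "[2 = 0] (mod n)"
        by (simp only: cong_add_lcancel_nat)
      \<comment> \<open>Turning back is possible only if \<open>n\<close> divides 2, and then
        \<open>s\<close> and \<open>- s\<close> agree modulo \<open>n\<close>, so the step goes in
        direction \<open>s\<close> all the same.\<close>
      then have "int n dvd 2"
        by (metis cong_0_iff int_dvd_int_iff of_nat_numeral)
      then have "[g (Suc k) - s = g (Suc k) + s] (mod int n)"
        using s(1) by (auto simp: cong_iff_dvd_diff)
      then show False
        using * \<open>[g (Suc (Suc k)) = g (Suc k) - s] (mod int n)\<close> cong_trans by blast
    qed
  qed
  have lin: "[g k = s * int k + g 0] (mod int n)" for k
  proof (induction k)
    case (Suc k)
    have "[g k + s = s * int k + g 0 + s] (mod int n)"
      by (intro cong_add Suc.IH cong_refl)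
    with succ have "[g (Suc k) = s * int k + g 0 + s] (mod int n)"
      by (rule cong_trans)
    then show ?case
      by (simp add: algebra_simps)
  qed simp
  have "int (\<sigma> i) = (s * int i + g 0) mod int n" if "i < n" for i
    using lin[of i] that im[OF that] by (simp add: cong_def g_def)
  then show thesis
    using s(1) that by blast
qed

text \<open>For \<open>n = 1\<close> the position 0 is its own successor, so only the empty set
  remains, in accordance with the convention for Lucas strings of length 1.\<close>

definition cycle_indep :: "nat \<Rightarrow> nat set set" where
  "cycle_indep n = {A. A \<subseteq> {..<n} \<and> (\<forall>i\<in>A. Suc i mod n \<notin> A)}"

lemma singleton_in_cycle_indep:
  assumes "2 \<le> n"
  shows "{i} \<in> cycle_indep n \<longleftrightarrow> i < n"
proof -
  have "Suc i mod n \<noteq> i" if "i < n"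
    using that assms by (auto simp: mod_Suc)
  then show ?thesis
    by (auto simp: cycle_indep_def)
qed

lemma doubleton_in_cycle_indep:
  assumes "2 \<le> n" "i < n" "j < n"
  shows "{i, j} \<in> cycle_indep n \<longleftrightarrow> j \<noteq> Suc i mod n \<and> i \<noteq> Suc j mod n"
proof -
  have "Suc i mod n \<noteq> i" "Suc j mod n \<noteq> j"
    using assms by (auto simp: mod_Suc)
  then show ?thesis
    using assms by (auto simp: cycle_indep_def)
qed

text \<open>The empty set is the only vertex of degree \<open>n\<close>: a nonempty member cannot be extended by the
  successor of one of its elements.\<close>

lemma cycle_indep_automorphism_empty:
  assumes n: "2 \<le> n"
    and bij: "bij_betw f (cycle_indep n) (cycle_indep n)"
    and adj: "\<And>A B. A \<in> cycle_indep n \<Longrightarrow> B \<in> cycle_indep n \<Longrightarrow>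
      is_singleton (sym_diff A B) \<longleftrightarrow> is_singleton (sym_diff (f A) (f B))"
  shows "f {} = {}"
proof -
  let ?V = "cycle_indep n"
  define N where "N A = {B \<in> ?V. is_singleton (sym_diff A B)}" for A
  define E where "E = f {}"
  have "{} \<in> ?V"
    by (simp add: cycle_indep_def)
  have fV: "f ` ?V = ?V"
    using bij by (simp add: bij_betw_def)
  then have "E \<in> ?V"
    using \<open>{} \<in> ?V\<close> unfolding E_def by blast
  have "N {} = (\<lambda>i. {i}) ` {..<n}"
    using singleton_in_cycle_indep[OF n] by (auto simp: N_def is_singleton_def)
  then have "card (N {}) = n"
    by (simp add: card_image)
  moreover have "f ` N {} = N E"
  proof
    show "f ` N {} \<subseteq> N E"
    proof
      fix C assume "C \<in> f ` N {}"
      then obtain B where B: "B \<in> ?V" "is_singleton (sym_diff {} B)" "C = f B"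
        by (auto simp only: N_def)
      then show "C \<in> N E"
        using fV adj[OF \<open>{} \<in> ?V\<close> B(1)] by (simp only: N_def E_def) blast
    qed
    show "N E \<subseteq> f ` N {}"
    proof
      fix C assume "C \<in> N E"
      then have "C \<in> f ` ?V" "is_singleton (sym_diff E C)"
        using fV by (simp_all only: N_def mem_Collect_eq)
      then obtain B where B: "B \<in> ?V" "C = f B" "is_singleton (sym_diff E (f B))"
        by (auto simp only:)
      then have "B \<in> N {}"
        using adj[OF \<open>{} \<in> ?V\<close> B(1)] by (simp only: N_def E_def mem_Collect_eq simp_thms)
      then show "C \<in> f ` N {}"
        using B(2) by (rule rev_image_eqI)
    qed
  qed
  moreover have "inj_on f (N {})"
    using bij by (auto simp: bij_betw_def N_def intro: inj_on_subset)
  ultimately have card: "card (N E) = n"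
    using card_image by fastforce
  have sub: "N E \<subseteq> (\<lambda>i. sym_diff E {i}) ` {..<n}"
  proof
    fix B assume "B \<in> N E"
    then obtain i where i: "sym_diff E B = {i}" and "B \<in> ?V"
      unfolding N_def is_singleton_def by blast
    have "i < n"
      using i \<open>B \<in> ?V\<close> \<open>E \<in> ?V\<close> unfolding cycle_indep_def by blast
    moreover have "B = sym_diff E {i}"
      using i by blast
    ultimately show "B \<in> (\<lambda>i. sym_diff E {i}) ` {..<n}"
      by blast
  qed
  \<comment> \<open>There is at most one neighbour of \<open>E\<close> per toggled position. Since
    \<open>E\<close> has \<open>n\<close> neighbours, every single toggle must stay in the
    family.\<close>
  have all: "N E = (\<lambda>i. sym_diff E {i}) ` {..<n}"
    using card_image_le[of "{..<n}" "\<lambda>i. sym_diff E {i}"] card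
    by (intro card_seteq sub) simp_all
  have False if "a \<in> E" for a
  proof -
    have a: "a < n" "Suc a mod n \<notin> E" "Suc a mod n < n" "a \<noteq> Suc a mod n"
      using that \<open>E \<in> ?V\<close> n by (auto simp: cycle_indep_def)
    then have "sym_diff E {Suc a mod n} \<in> ?V"
      using all unfolding N_def by blast
    moreover have "a \<in> sym_diff E {Suc a mod n}" "Suc a mod n \<in> sym_diff E {Suc a mod n}"
      using a that by auto
    ultimately show False
      unfolding cycle_indep_def by blast
  qed
  then show ?thesis
    unfolding E_def by blast
qed

text \<open>The independent sets form a simplicial complex whose vertices are all positions as soon
  as \<open>2 \<le> n\<close>, so \<open>f\<close> is induced by a permutation
  \<open>\<sigma>\<close> of the positions. Non-edges of the cycle are the two-element members,
  which makes \<open>\<sigma>\<close> an automorphism of the cycle.\<close>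

lemma cycle_indep_automorphism:
  assumes n: "0 < n"
    and bij: "bij_betw f (cycle_indep n) (cycle_indep n)"
    and adj: "\<And>A B. A \<in> cycle_indep n \<Longrightarrow> B \<in> cycle_indep n \<Longrightarrow>
      is_singleton (sym_diff A B) \<longleftrightarrow> is_singleton (sym_diff (f A) (f B))"
  obtains s c :: int where "s \<in> {1, -1}"
    "\<And>A. A \<in> cycle_indep n \<Longrightarrow> f A = (\<lambda>i. nat ((s * int i + c) mod int n)) ` A"
proof (cases "n = 1")
  case True
  have V: "cycle_indep n = {{}}"
    using True by (auto simp: cycle_indep_def)
  show thesis
    \<comment> \<open>The empty set is the only member, so any parameters would serve.\<close>
    by (rule that[of 1 0]) (use bij V in \<open>auto simp: bij_betw_def\<close>)
next
  case False
  with n have n2: "2 \<le> n" by simp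
  let ?V = "cycle_indep n"
  obtain \<sigma> where \<sigma>: "bij_betw \<sigma> {..<n} {..<n}" "\<And>A. A \<in> ?V \<Longrightarrow> f A = \<sigma> ` A"
  proof (rule simplicial_complex_automorphism[of ?V f])
    show "f {} = {}"
      by (rule cycle_indep_automorphism_empty[OF n2 bij adj])
    show "finite A" if "A \<in> ?V" for A
      using that by (auto simp: cycle_indep_def intro: finite_subset)
    show "B \<in> ?V" if "A \<in> ?V" "B \<subseteq> A" for A B
      using that unfolding cycle_indep_def by blast
    have "{x. {x} \<in> ?V} = {..<n}"
      using singleton_in_cycle_indep[OF n2] by auto
    then show thesis
      if "bij_betw \<sigma> {x. {x} \<in> ?V} {x. {x} \<in> ?V}" "\<And>A. A \<in> ?V \<Longrightarrow> f A = \<sigma> ` A" for \<sigma>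
      using that \<open>\<And>\<sigma>. \<lbrakk>bij_betw \<sigma> {..<n} {..<n}; \<And>A. A \<in> ?V \<Longrightarrow> f A = \<sigma> ` A\<rbrakk> \<Longrightarrow> thesis\<close> by simp
  qed (use bij adj in auto)
  have \<sigma>n: "\<sigma> i < n" if "i < n" for i
    using \<sigma>(1) that by (auto simp: bij_betw_def)
  have \<sigma>i: "i = j" if "\<sigma> i = \<sigma> j" "i < n" "j < n" for i j
    using \<sigma>(1) that by (auto simp: bij_betw_def dest: inj_onD)
  obtain s c :: int where "s \<in> {1, -1}" and sc: "\<And>i. i < n \<Longrightarrow> int (\<sigma> i) = (s * int i + c) mod int n"
  proof (rule cycle_automorphism[OF n])
    show "inj_on \<sigma> {..<n}"
      using \<sigma>(1) by (simp add: bij_betw_def)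
    show "\<sigma> i < n" if "i < n" for i
      by (rule \<sigma>n[OF that])
    show "\<sigma> (Suc i mod n) = Suc (\<sigma> i) mod n \<or> \<sigma> i = Suc (\<sigma> (Suc i mod n)) mod n"
      if i: "i < n" for i
    proof (rule ccontr)
      let ?j = "Suc i mod n"
      have j: "?j < n" using n by simp
      assume "\<not> ?thesis"
      \<comment> \<open>If the images of two consecutive positions were not adjacent, they would
        form a member, and its preimage under \<open>f\<close> would be a member containing both
        consecutive positions.\<close>
      then have "{\<sigma> i, \<sigma> ?j} \<in> ?V"
        using doubleton_in_cycle_indep[OF n2 \<sigma>n[OF i] \<sigma>n[OF j]] by simp
      then obtain A where A: "A \<in> ?V" "f A = {\<sigma> i, \<sigma> ?j}"
        using bij by (metis bij_betw_def imageE)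
      then have "\<sigma> ` A = {\<sigma> i, \<sigma> ?j}" "A \<subseteq> {..<n}"
        using \<sigma>(2) by (auto simp: cycle_indep_def)
      have "k \<in> A" if "\<sigma> k \<in> \<sigma> ` A" "k < n" for k
      proof -
        obtain a where "a \<in> A" "\<sigma> k = \<sigma> a"
          using \<open>\<sigma> k \<in> \<sigma> ` A\<close> by (rule imageE)
        then show ?thesis
          using \<sigma>i[of k a] \<open>k < n\<close> \<open>A \<subseteq> {..<n}\<close> by blast
      qed
      then have "i \<in> A" "?j \<in> A"
        using \<open>\<sigma> ` A = {\<sigma> i, \<sigma> ?j}\<close> i j by blast+
      then show False
        using A(1) by (auto simp: cycle_indep_def)
    qed
  qed (use that in blast)
  have "f A = (\<lambda>i. nat ((s * int i + c) mod int n)) ` A" if "A \<in> ?V" for A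
  proof -
    have "\<sigma> i = nat ((s * int i + c) mod int n)" if "i \<in> A" for i
    proof -
      have "i < n" using that \<open>A \<in> ?V\<close> by (auto simp: cycle_indep_def)
      then show ?thesis using sc[of i] by linarith
    qed
    then show ?thesis
      using \<sigma>(2)[OF that] by (simp cong: image_cong)
  qed
  then show thesis
    using that \<open>s \<in> {1, -1}\<close> by blast
qed

section \<open>Cyclic words\<close>

text \<open>For \<open>u = []\<close> the modulus is 0 and \<open>cyc u\<close> is not meaningful.\<close>

definition cyc :: "'a list \<Rightarrow> int \<Rightarrow> 'a" where
  "cyc u i = u ! nat (i mod int (length u))"

text \<open>The values 1 and -1 of \<open>s\<close> give the rotations and the reflections of the
  cyclic word. Letters are pulled back along the index map, and \<open>c\<close> ranges over all
  integers so that parameters need no reduction.\<close>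

definition dihedral :: "int \<Rightarrow> int \<Rightarrow> 'a list \<Rightarrow> 'a list" where
  "dihedral s c u = map (\<lambda>i. cyc u (s * int i + c)) [0..<length u]"

lemma length_dihedral [simp]: "length (dihedral s c u) = length u"
  by (simp add: dihedral_def)

lemma cyc_cong: "[i = j] (mod int (length u)) \<Longrightarrow> cyc u i = cyc u j"
  by (simp add: cyc_def cong_def)

lemma cyc_of_nat: "i < length u \<Longrightarrow> cyc u (int i) = u ! i"
  by (simp add: cyc_def)

lemma cyc_eqI:
  assumes "length u = length v" "\<And>i. cyc u i = cyc v i"
  shows "u = v"
proof (rule nth_equalityI)
  show "u ! i = v ! i" if "i < length u" for i
    using assms that by (metis cyc_of_nat)
qed fact

text \<open>Affine maps respect congruence modulo the length. Composing and comparing dihedral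
  images thereby becomes integer arithmetic without any \<open>mod\<close>.\<close>

lemma cyc_dihedral:
  assumes "0 < length u"
  shows "cyc (dihedral s c u) i = cyc u (s * i + c)"
proof -
  define n where "n = int (length u)"
  have n: "0 < n"
    using assms by (simp add: n_def)
  have "cyc (dihedral s c u) i = cyc u (s * (i mod n) + c)"
    using n nat_less_iff[of "i mod n" "length u"] unfolding cyc_def[of "dihedral s c u"]
    by (simp add: dihedral_def flip: n_def)
  also have "[s * (i mod n) + c = s * i + c] (mod n)"
    by (intro cong_add cong_mult cong_refl) simp
  then have "cyc u (s * (i mod n) + c) = cyc u (s * i + c)"
    unfolding n_def by (rule cyc_cong)
  finally show ?thesis .
qed

lemma dihedral_eq_iff:
  assumes "0 < length u" "length v = length u"
  shows "dihedral s c u = dihedral t d v \<longleftrightarrow> (\<forall>i. cyc u (s * i + c) = cyc v (t * i + d))"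
  using assms by (metis cyc_dihedral cyc_eqI length_dihedral)

lemma dihedral_1_0: "0 < length u \<Longrightarrow> dihedral 1 0 u = u"
  by (rule cyc_eqI) (simp_all add: cyc_dihedral)

text \<open>Pulling back reverses the order of composition: index \<open>i\<close> first goes to
  \<open>s * i + c\<close> and only then through the map with parameters \<open>t\<close> and
  \<open>d\<close>.\<close>

lemma dihedral_dihedral:
  assumes "0 < length u"
  shows "dihedral s c (dihedral t d u) = dihedral (t * s) (t * c + d) u"
  using assms by (intro cyc_eqI) (simp_all add: cyc_dihedral algebra_simps)

text \<open>The condition on the first and last letters is the adjacency condition at
  \<open>n - 1\<close>, whose cyclic successor is 0. In this form the property is visibly invariant
  under rotation.\<close>

lemma lucas_string_iff_cyc:
  assumes "0 < n"
  shows "lucas_string n u \<longleftrightarrow> length u = n \<and> (\<forall>i. \<not> (cyc u i \<and> cyc u (i + 1)))"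
proof (cases "length u = n")
  case True
  have step: "cyc u (int k) = u ! k" "cyc u (int k + 1) = (if Suc k < n then u ! Suc k else u ! 0)"
    if "k < n" for k
  proof -
    show "cyc u (int k) = u ! k"
      using that True by (simp add: cyc_of_nat)
    show "cyc u (int k + 1) = (if Suc k < n then u ! Suc k else u ! 0)"
    proof (cases "Suc k < n")
      case True
      then show ?thesis
        using cyc_of_nat[of "Suc k" u] \<open>length u = n\<close> by (simp add: add.commute)
    next
      case False
      then have "int k + 1 = int n"
        using that by linarith
      then show ?thesis
        using False \<open>length u = n\<close> by (simp add: cyc_def)
    qed
  qed
  have "(\<forall>i. \<not> (cyc u i \<and> cyc u (i + 1))) \<longleftrightarrow> (\<forall>k<n. \<not> (cyc u (int k) \<and> cyc u (int k + 1)))"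
    (is "?L \<longleftrightarrow> ?R")
  proof
    assume R: ?R
    show ?L
    proof
      fix i
      define k where "k = nat (i mod int n)"
      have "0 \<le> i mod int n" "i mod int n < int n"
        using assms by simp_all
      then have "k < n" "int k = i mod int n"
        by (auto simp: k_def)
      then have k: "[int k = i] (mod int (length u))"
        using True by (simp add: cong_def)
      have "cyc u (int k) = cyc u i" "cyc u (int k + 1) = cyc u (i + 1)"
        by (intro cyc_cong k cong_add cong_refl)+
      then show "\<not> (cyc u i \<and> cyc u (i + 1))"
        using R \<open>k < n\<close> by metis
    qed
  qed simp
  also have "\<dots> \<longleftrightarrow> (\<forall>k<n. \<not> (u ! k \<and> (if Suc k < n then u ! Suc k else u ! 0)))"
    using step by (simp cong: imp_cong)
  also have "\<dots> \<longleftrightarrow> (\<forall>k. Suc k < n \<longrightarrow> \<not> (u ! k \<and> u ! Suc k)) \<and> \<not> (u ! 0 \<and> u ! (n - 1))"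
    (is "?P \<longleftrightarrow> ?Q")
  proof
    assume P: ?P
    have "\<not> (u ! k \<and> u ! Suc k)" if "Suc k < n" for k
      using P that by (metis Suc_lessD)
    moreover have "\<not> (u ! 0 \<and> u ! (n - 1))"
      using P[rule_format, of "n - 1"] assms by auto
    ultimately show ?Q by blast
  next
    assume Q: ?Q
    show ?P
    proof (intro allI impI)
      fix k assume "k < n"
      then consider "Suc k < n" | "k = n - 1" "\<not> Suc k < n" by linarith
      then show "\<not> (u ! k \<and> (if Suc k < n then u ! Suc k else u ! 0))"
        by cases (use Q in auto)
    qed
  qed
  finally show ?thesis
    using True assms by (simp add: lucas_string_def)
qed (simp add: lucas_string_def)

lemma lucas_string_dihedral:
  assumes "0 < n" "s \<in> {1, -1}" "lucas_string n u"
  shows "lucas_string n (dihedral s c u)"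
proof -
  have u: "length u = n" "\<not> (cyc u i \<and> cyc u (i + 1))" for i
    using assms lucas_string_iff_cyc by auto
  have "\<not> (cyc u (s * i + c) \<and> cyc u (s * (i + 1) + c))" for i
    \<comment> \<open>For \<open>s = -1\<close> the two neighbouring indices swap their order, so
      the condition is needed starting from either of them.\<close>
    using u(2)[of "s * i + c"] u(2)[of "s * (i + 1) + c"] assms(2)
    by (auto simp: algebra_simps)
  then show ?thesis
    using assms(1) u(1) by (simp add: lucas_string_iff_cyc cyc_dihedral)
qed

lemma dihedral_inverse:
  assumes "0 < length u" "s \<in> {1, -1}"
  shows "dihedral s (- (s * c)) (dihedral s c u) = u" "dihedral s c (dihedral s (- (s * c)) u) = u"
  using assms dihedral_1_0[of u] by (auto simp: dihedral_dihedral)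

text \<open>Since \<open>s * s = 1\<close>, multiplying the divisibility condition by
  \<open>s\<close> solves it for \<open>x\<close>. The bounds make \<open>x\<close> and
  \<open>y\<close> their own residues.\<close>

lemma affine_mod_eq_iff:
  fixes s c x y n :: int
  assumes "s \<in> {1, -1}" "0 \<le> x" "x < n" "0 \<le> y" "y < n"
  shows "(s * x + c) mod n = y \<longleftrightarrow> x = (s * y - s * c) mod n"
proof -
  have "(s * x + c) mod n = y \<longleftrightarrow> n dvd s * x + c - y"
    using assms by (metis mod_eq_dvd_iff mod_pos_pos_trivial)
  also have "\<dots> \<longleftrightarrow> n dvd s * (s * x + c - y)"
    using assms(1) by (auto simp: dvd_diff_commute algebra_simps)
  also have "s * (s * x + c - y) = x - (s * y - s * c)"
    using assms(1) by auto
  also have "n dvd \<dots> \<longleftrightarrow> x = (s * y - s * c) mod n"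
    using assms by (metis mod_eq_dvd_iff mod_pos_pos_trivial)
  finally show ?thesis .
qed

lemma nat_affine_mod_eq_iff:
  assumes "s \<in> {1, -1}" "i < n" "j < n"
  shows "nat ((s * int i + c) mod int n) = j \<longleftrightarrow> i = nat ((s * int j - s * c) mod int n)"
  using affine_mod_eq_iff[of s "int i" "int n" "int j" c] assms
  by (auto simp: nat_eq_iff nat_eq_iff2)

text \<open>The index map \<open>\<tau>\<close> permutes the positions and thus carries the
  differing positions of the images bijectively to those of \<open>u\<close> and
  \<open>v\<close>.\<close>

lemma card_diff_dihedral:
  assumes "length u = n" "length v = n" "s \<in> {1, -1}"
  shows "card {i. i < n \<and> dihedral s c u ! i \<noteq> dihedral s c v ! i} = card {i. i < n \<and> u ! i \<noteq> v ! i}"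
proof (cases "n = 0")
  case False
  then have n: "0 < int n" by simp
  define \<tau> where "\<tau> i = nat ((s * int i + c) mod int n)" for i
  have \<tau>n: "\<tau> i < n" for i
    using n nat_less_iff by (simp add: \<tau>_def)
  have \<tau>_iff: "\<tau> i = j \<longleftrightarrow> i = nat ((s * int j - s * c) mod int n)" if "i < n" "j < n" for i j
    unfolding \<tau>_def by (rule nat_affine_mod_eq_iff[OF assms(3) that])
  have nth: "dihedral s c w ! i = w ! \<tau> i" if "length w = n" "i < n" for w :: "'a list" and i
    using that by (simp add: dihedral_def cyc_def \<tau>_def)
  have "{i. i < n \<and> u ! i \<noteq> v ! i} = \<tau> ` {i. i < n \<and> u ! \<tau> i \<noteq> v ! \<tau> i}"
  proof (intro subset_antisym subsetI)
    fix j assume j: "j \<in> {i. i < n \<and> u ! i \<noteq> v ! i}"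
    define i where "i = nat ((s * int j - s * c) mod int n)"
    have "i < n" using n nat_less_iff by (simp add: i_def)
    then have "\<tau> i = j"
      using \<tau>_iff[of i j] j by (simp add: i_def)
    then show "j \<in> \<tau> ` {i. i < n \<and> u ! \<tau> i \<noteq> v ! \<tau> i}"
      using j \<open>i < n\<close> by blast
  qed (use \<tau>n in auto)
  moreover have "inj_on \<tau> {i. i < n \<and> u ! \<tau> i \<noteq> v ! \<tau> i}"
    using \<tau>_iff \<tau>n by (intro inj_onI) (metis (mono_tags, lifting) mem_Collect_eq)
  moreover have "{i. i < n \<and> dihedral s c u ! i \<noteq> dihedral s c v ! i} =
      {i. i < n \<and> u ! \<tau> i \<noteq> v ! \<tau> i}"
    using nth assms by (intro Collect_cong conj_cong refl) simp
  ultimately show ?thesis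
    by (simp add: card_image)
qed simp

section \<open>Orbits of the Lucas cube\<close>

lemma verts_lucas_cube: "verts (lucas_cube n) = {u. lucas_string n u}"
  by (simp add: lucas_cube_def)

lemma dominates_lucas_cube:
  "u \<rightarrow>\<^bsub>lucas_cube n\<^esub> v \<longleftrightarrow>
    lucas_string n u \<and> lucas_string n v \<and> card {i. i < n \<and> u ! i \<noteq> v ! i} = 1"
  by (auto simp: lucas_cube_def hypercube_def induce_subgraph_def arcs_ends_conv with_proj_def
      lucas_string_def)

lemma dihedral_in_graph_aut:
  assumes "0 < n" "s \<in> {1, -1}"
  shows "restrict (dihedral s c) {u. lucas_string n u} \<in> graph_aut (lucas_cube n)"
proof -
  let ?L = "{u. lucas_string n u}"
  have len: "length u = n" if "lucas_string n u" for u
    using that by (simp add: lucas_string_def)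
  have "dihedral s (- (s * c)) (dihedral s c u) = u" "dihedral s c (dihedral s (- (s * c)) u) = u"
    if "lucas_string n u" for u
    using dihedral_inverse[OF _ assms(2), of u c] len[OF that] assms(1) by simp_all
  then have "bij_betw (dihedral s c) ?L ?L"
    using lucas_string_dihedral[OF assms]
    by (intro bij_betw_byWitness[where f' = "dihedral s (- (s * c))"]) auto
  then have "restrict (dihedral s c) ?L \<in> Bij ?L"
    by (simp add: Bij_def)
  then show ?thesis
    using lucas_string_dihedral[OF assms] card_diff_dihedral[OF len len assms(2)]
    by (simp add: graph_aut_def verts_lucas_cube dominates_lucas_cube)
qed

section \<open>Lucas strings as independent sets of the cycle\<close>

definition ones :: "bool list \<Rightarrow> nat set" where
  "ones u = {i. i < length u \<and> u ! i}"

lemma lucas_string_iff_ones: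
  assumes "0 < n"
  shows "lucas_string n u \<longleftrightarrow> length u = n \<and> ones u \<in> cycle_indep n"
proof (intro iffI conjI)
  assume L: "lucas_string n u"
  then show len: "length u = n"
    by (simp add: lucas_string_def)
  have "\<not> u ! (Suc i mod n)" if "i < n" "u ! i" for i
  proof -
    have "cyc u (int i)" "cyc u (int i + 1) = u ! (Suc i mod n)"
      using that len by (simp_all add: cyc_def nat_mod_as_int add.commute)
    then show ?thesis
      using L lucas_string_iff_cyc[OF assms] by metis
  qed
  then show "ones u \<in> cycle_indep n"
    using len by (auto simp: cycle_indep_def ones_def)
next
  assume "length u = n \<and> ones u \<in> cycle_indep n"
  then have len: "length u = n" and *: "\<And>i. i < n \<Longrightarrow> u ! i \<Longrightarrow> \<not> u ! (Suc i mod n)"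
    using assms by (auto simp: cycle_indep_def ones_def)
  then show "lucas_string n u"
    unfolding lucas_string_def
  proof (intro conjI allI impI)
    show "\<not> (u ! i \<and> u ! Suc i)" if "Suc i < n" for i
      using *[of i] that by auto
    show "\<not> (0 < n \<and> u ! 0 \<and> u ! (n - 1))"
      using *[of "n - 1"] by auto
  qed
qed

lemma bij_betw_ones:
  assumes "0 < n"
  shows "bij_betw ones {u. lucas_string n u} (cycle_indep n)"
proof (rule bij_betw_byWitness[where f' = "\<lambda>A. map (\<lambda>i. i \<in> A) [0..<n]"])
  have *: "ones (map (\<lambda>i. i \<in> A) [0..<n]) = A" if "A \<in> cycle_indep n" for A
    using that by (auto simp: ones_def cycle_indep_def)
  then show "\<forall>A\<in>cycle_indep n. ones (map (\<lambda>i. i \<in> A) [0..<n]) = A"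
    by blast
  show "(\<lambda>A. map (\<lambda>i. i \<in> A) [0..<n]) ` cycle_indep n \<subseteq> {u. lucas_string n u}"
    using * by (auto simp: lucas_string_iff_ones[OF assms])
  show "\<forall>u\<in>{u. lucas_string n u}. map (\<lambda>i. i \<in> ones u) [0..<n] = u"
    by (auto simp: lucas_string_def ones_def intro: nth_equalityI)
  show "ones ` {u. lucas_string n u} \<subseteq> cycle_indep n"
    using lucas_string_iff_ones[OF assms] by blast
qed

lemma is_singleton_sym_diff_ones:
  assumes "length u = n" "length v = n"
  shows "is_singleton (sym_diff (ones u) (ones v)) \<longleftrightarrow> card {i. i < n \<and> u ! i \<noteq> v ! i} = 1"
proof -
  have "sym_diff (ones u) (ones v) = {i. i < n \<and> u ! i \<noteq> v ! i}"
    using assms by (auto simp: ones_def)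
  then show ?thesis
    by (simp add: is_singleton_altdef)
qed

text \<open>Conjugation with the bijection \<open>ones\<close> turns \<open>f\<close> into an
  automorphism of the complex of independent sets, which is already known to be induced by an affine
  map of the positions.\<close>

lemma graph_aut_lucas_cube_dihedral:
  assumes n: "0 < n" and f: "f \<in> graph_aut (lucas_cube n)"
  obtains s c where "s \<in> {1, -1}" "\<And>u. lucas_string n u \<Longrightarrow> f u = dihedral s c u"
proof -
  let ?L = "{u. lucas_string n u}"
  have fb: "bij_betw f ?L ?L"
    and fa: "\<And>u v. lucas_string n u \<Longrightarrow> lucas_string n v \<Longrightarrow>
      card {i. i < n \<and> u ! i \<noteq> v ! i} = 1 \<longleftrightarrow> card {i. i < n \<and> f u ! i \<noteq> f v ! i} = 1"
    using f by (auto simp: graph_aut_def verts_lucas_cube dominates_lucas_cube Bij_def bij_betw_def)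
  have fL: "lucas_string n (f u)" if "lucas_string n u" for u
    using fb that by (auto simp: bij_betw_def)
  have len: "length u = n" if "lucas_string n u" for u
    using that by (simp add: lucas_string_def)
  define h where "h = inv_into ?L ones"
  have hb: "bij_betw h (cycle_indep n) ?L"
    unfolding h_def by (rule bij_betw_inv_into[OF bij_betw_ones[OF n]])
  have hL: "lucas_string n (h A)" and oh: "ones (h A) = A" if "A \<in> cycle_indep n" for A
    using hb that bij_betw_inv_into_right[OF bij_betw_ones[OF n] that]
    by (auto simp: h_def bij_betw_def)
  have ho: "h (ones u) = u" if "lucas_string n u" for u
    using bij_betw_inv_into_left[OF bij_betw_ones[OF n]] that by (simp add: h_def)
  obtain s c where s: "s \<in> {1, -1}"
    and F: "\<And>A. A \<in> cycle_indep n \<Longrightarrow> (ones \<circ> f \<circ> h) A = (\<lambda>i. nat ((s * int i + c) mod int n)) ` A"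
  proof (rule cycle_indep_automorphism[OF n])
    show "bij_betw (ones \<circ> f \<circ> h) (cycle_indep n) (cycle_indep n)"
      using bij_betw_trans[OF bij_betw_trans[OF hb fb] bij_betw_ones[OF n]] by (simp add: comp_assoc)
    show "is_singleton (sym_diff A B) \<longleftrightarrow>
        is_singleton (sym_diff ((ones \<circ> f \<circ> h) A) ((ones \<circ> f \<circ> h) B))"
      if "A \<in> cycle_indep n" "B \<in> cycle_indep n" for A B
      using is_singleton_sym_diff_ones[of "h A" n "h B"] fa[of "h A" "h B"]
        is_singleton_sym_diff_ones[of "f (h A)" n "f (h B)"] that hL oh fL len by simp
  qed (use that in blast)
  \<comment> \<open>The set of ones is pushed forward along the index map, whereas
    \<open>dihedral\<close> pulls letters back, so the parameters of the inverse map appear.\<close>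
  have "f u = dihedral s (- (s * c)) u" if u: "lucas_string n u" for u
  proof (rule nth_equalityI)
    show "length (f u) = length (dihedral s (- (s * c)) u)"
      using len fL u by simp
    fix j assume "j < length (f u)"
    then have j: "j < n"
      using len fL u by simp
    define i where "i = nat ((s * int j - s * c) mod int n)"
    have i: "i < n"
      using n nat_less_iff by (simp add: i_def)
    have iff: "nat ((s * int k + c) mod int n) = j \<longleftrightarrow> k = i" if "k < n" for k
      unfolding i_def by (rule nat_affine_mod_eq_iff[OF s that j])
    have "f u ! j \<longleftrightarrow> j \<in> ones (f u)"
      using j len fL u by (simp add: ones_def)
    also have "ones (f u) = (\<lambda>i. nat ((s * int i + c) mod int n)) ` ones u"
      using F[of "ones u"] ho[OF u] u lucas_string_iff_ones[OF n] by simp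
    also have "j \<in> \<dots> \<longleftrightarrow> i \<in> ones u"
    proof
      assume "j \<in> (\<lambda>i. nat ((s * int i + c) mod int n)) ` ones u"
      then obtain k where "k \<in> ones u" "j = nat ((s * int k + c) mod int n)"
        by blast
      then show "i \<in> ones u"
        using iff[of k] len[OF u] by (auto simp: ones_def)
    next
      assume "i \<in> ones u"
      then show "j \<in> (\<lambda>i. nat ((s * int i + c) mod int n)) ` ones u"
        using iff[OF i] by (intro image_eqI[of _ _ i]) simp_all
    qed
    also have "\<dots> \<longleftrightarrow> dihedral s (- (s * c)) u ! j"
      using i j len[OF u] by (simp add: ones_def dihedral_def cyc_def i_def)
    finally show "f u ! j = dihedral s (- (s * c)) u ! j" .
  qed
  then show thesis
    using s that by blast
qed

lemma vertex_orbits_lucas_cube: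
  assumes "0 < n"
  shows "vertex_orbits (lucas_cube n) =
    {range (\<lambda>c. dihedral 1 c u) \<union> range (\<lambda>c. dihedral (-1) c u) | u. lucas_string n u}"
proof -
  have eq: "orbit (graph_AutGroup (lucas_cube n)) (\<lambda>f. f) u =
      range (\<lambda>c. dihedral 1 c u) \<union> range (\<lambda>c. dihedral (-1) c u)" (is "?O = ?R")
    if u: "lucas_string n u" for u
  proof
    show "?O \<subseteq> ?R"
    proof
      fix v assume "v \<in> ?O"
      then obtain f where f: "f \<in> graph_aut (lucas_cube n)" "v = f u"
        by (auto simp: orbit_def graph_AutGroup_def)
      then obtain s c where "s \<in> {1, -1}" "v = dihedral s c u"
        using graph_aut_lucas_cube_dihedral[OF assms] u by metis
      then show "v \<in> ?R" by auto
    qed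
    have "dihedral s c u \<in> ?O" if "s \<in> {1, -1}" for s c
    proof -
      have "dihedral s c u = restrict (dihedral s c) {u. lucas_string n u} u"
        using u by simp
      moreover have "restrict (dihedral s c) {u. lucas_string n u} \<in>
          carrier (graph_AutGroup (lucas_cube n))"
        using dihedral_in_graph_aut[OF assms that] by (simp add: graph_AutGroup_def)
      ultimately show ?thesis
        unfolding orbit_def by blast
    qed
    then show "?R \<subseteq> ?O" by blast
  qed
  show ?thesis
    unfolding vertex_orbits_def orbits_def verts_lucas_cube
    by (intro Collect_cong ex_cong1) (metis eq mem_Collect_eq)
qed

section \<open>Orbit sizes\<close>

text \<open>The integers \<open>a\<close> with \<open>h a = h 0\<close> form a subgroup, generated
  by its least positive element \<open>d\<close>. Distinct values of \<open>h\<close> then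
  correspond to residues modulo \<open>d\<close>.\<close>

lemma card_range_shift_invariant:
  fixes h :: "int \<Rightarrow> 'b"
  assumes "0 < n" and shift: "\<And>a b c. h a = h b \<Longrightarrow> h (a + c) = h (b + c)"
    and per: "h (int n) = h 0"
  obtains d where "0 < d" "d dvd n" "card (range h) = d" "\<And>a. h a = h 0 \<longleftrightarrow> int d dvd a"
proof -
  define d where "d = (LEAST d. 0 < d \<and> h (int d) = h 0)"
  have d: "0 < d" "h (int d) = h 0"
    using LeastI[of "\<lambda>d. 0 < d \<and> h (int d) = h 0" n] assms by (auto simp: d_def)
  have least: "d \<le> m" if "0 < m" "h (int m) = h 0" for m
    unfolding d_def using that by (intro Least_le) simp
  have mult_nat: "h (a + int d * int k) = h a" for a k
  proof (induction k)
    case (Suc k)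
    have "h (int d + (a + int d * int k)) = h (0 + (a + int d * int k))"
      by (rule shift[OF d(2)])
    then show ?case
      using Suc by (simp add: algebra_simps)
  qed simp
  have mult: "h (a + int d * k) = h a" for a k
  proof (cases "0 \<le> k")
    case True
    then show ?thesis using mult_nat[of a "nat k"] by (simp only: int_nat_eq if_True)
  next
    case False
    \<comment> \<open>For negative \<open>k\<close> the natural multiple is applied at the point
      \<open>a + int d * k\<close>, from which it leads back up to \<open>a\<close>.\<close>
    then have "int (nat (- k)) = - k" by simp
    then have "a + int d * k + int d * int (nat (- k)) = a" by simp
    then show ?thesis using mult_nat[of "a + int d * k" "nat (- k)"] by (simp only:)
  qed
  have h_mod: "h (a mod int d) = h a" for a
    using mult[of "a mod int d" "a div int d"] by (simp only: mod_mult_div_eq)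
  have zero_iff: "h a = h 0 \<longleftrightarrow> int d dvd a" for a
  proof
    assume a: "h a = h 0"
    show "int d dvd a"
    proof (rule ccontr)
      assume "\<not> int d dvd a"
      then have "a mod int d \<noteq> 0"
        by (simp only: dvd_eq_mod_eq_0 not_False_eq_True)
      moreover have "0 \<le> a mod int d" "a mod int d < int d"
        using d(1) by simp_all
      ultimately have "0 < a mod int d"
        by linarith
      then show False
        using least[of "nat (a mod int d)"] h_mod[of a] a \<open>a mod int d < int d\<close> by simp
    qed
  next
    assume "int d dvd a"
    then show "h a = h 0"
      using mult[of 0] by auto
  qed
  have "inj_on h {0..<int d}"
  proof (rule inj_onI)
    fix a b assume ab: "a \<in> {0..<int d}" "b \<in> {0..<int d}" "h a = h b"
    then have "h (a + - b) = h (b + - b)"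
      by (intro shift)
    then have "int d dvd a - b"
      using zero_iff by simp
    then have "a mod int d = b mod int d"
      by (simp add: mod_eq_dvd_iff)
    then show "a = b"
      using ab by simp
  qed
  moreover have "range h = h ` {0..<int d}"
  proof (intro subset_antisym subsetI)
    fix x assume "x \<in> range h"
    then obtain a where "x = h (a mod int d)"
      using h_mod by auto
    then show "x \<in> h ` {0..<int d}"
      using d(1) by simp
  qed auto
  ultimately have "card (range h) = d"
    by (simp add: card_image)
  moreover have "d dvd n"
    using zero_iff per by auto
  ultimately show thesis
    using that d(1) zero_iff by blast
qed

text \<open>With \<open>d\<close> the least period there are \<open>d\<close> distinct rotations.
  Reversing them gives all reflected words, hence again \<open>d\<close> of them, and the two sets
  are equal or disjoint according to whether some reflection fixes the cyclic word.\<close>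

lemma card_dihedral_orbit:
  assumes "0 < n" "length u = n"
  obtains d where "0 < d" "d dvd n"
    "\<And>a. (\<forall>i. cyc u (i + a) = cyc u i) \<longleftrightarrow> int d dvd a"
    "card (range (\<lambda>c. dihedral 1 c u) \<union> range (\<lambda>c. dihedral (-1) c u)) =
      (if \<exists>c. \<forall>i. cyc u (c - i) = cyc u i then d else 2 * d)"
proof -
  let ?R = "range (\<lambda>c. dihedral 1 c u)" and ?R' = "range (\<lambda>c. dihedral (-1) c u)"
  have u: "0 < length u" using assms by simp
  have shift: "dihedral 1 (a + c) u = dihedral 1 (b + c) u" if "dihedral 1 a u = dihedral 1 b u" for a b c
    using that dihedral_dihedral[OF u, of 1 c 1 a] dihedral_dihedral[OF u, of 1 c 1 b]
    by (simp add: add.commute)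
  have "dihedral 1 (int n) u = dihedral 1 0 u"
    using assms by (auto simp: dihedral_eq_iff[OF u] cong_def intro!: cyc_cong)
  then obtain d where d: "0 < d" "d dvd n" "card ?R = d"
    "\<And>a. dihedral 1 a u = dihedral 1 0 u \<longleftrightarrow> int d dvd a"
    using card_range_shift_invariant[where h = "\<lambda>c. dihedral 1 c u", OF assms(1) shift] by blast
  have R': "?R' = dihedral (-1) 0 ` ?R"
    by (auto simp: image_image dihedral_dihedral[OF u])
  have "inj_on (dihedral (-1) 0) ?R"
    by (rule inj_on_inverseI[where g = "dihedral (-1) 0"]) (auto simp: dihedral_dihedral[OF u])
  then have cardR': "card ?R' = d"
    unfolding R' using d(3) by (simp only: card_image)
  have fin: "finite ?R" "finite ?R'"
    using d(1,3) cardR' by (auto intro: card_ge_0_finite)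
  have "card (?R \<union> ?R') = (if \<exists>c. \<forall>i. cyc u (c - i) = cyc u i then d else 2 * d)"
  proof (cases "\<exists>c. \<forall>i. cyc u (c - i) = cyc u i")
    case True
    then obtain c where c: "\<And>i. cyc u (c - i) = cyc u i" by blast
    have "dihedral (-1) b u = dihedral 1 (c - b) u" for b
      using c[of "b - i" for i] by (simp add: dihedral_eq_iff[OF u] algebra_simps)
    then have "?R' \<subseteq> ?R" by auto
    then show ?thesis
      using True d(3) by (simp add: Un_absorb2)
  next
    case False
    have "?R \<inter> ?R' = {}"
    proof (rule ccontr)
      assume "?R \<inter> ?R' \<noteq> {}"
      then obtain a b where "dihedral 1 a u = dihedral (-1) b u" by auto
      then have "cyc u (i + a) = cyc u (b - i)" for i
        by (simp add: dihedral_eq_iff[OF u])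
      \<comment> \<open>A word that is both a rotation and a reflected image of \<open>u\<close>
        yields a reflection symmetry of \<open>u\<close> itself.\<close>
      from this[of "i - a" for i] have "cyc u ((a + b) - i) = cyc u i" for i
        by (simp add: algebra_simps)
      then show False using False by blast
    qed
    then show ?thesis
      unfolding if_not_P[OF False] using fin d(3) cardR' by (simp add: card_Un_disjoint)
  qed
  moreover have "(\<forall>i. cyc u (i + a) = cyc u i) \<longleftrightarrow> int d dvd a" for a
    using d(4)[of a] by (simp add: dihedral_eq_iff[OF u])
  ultimately show thesis
    using that d(1,2) by blast
qed

section \<open>Lucas strings with prescribed orbit size\<close>

text \<open>Witnesses can thus be written as periodic predicates on the integers; reading off
  \<open>n\<close> letters is consistent because the period \<open>k\<close> divides
  \<open>n\<close>.\<close>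

lemma ex_lucas_string_cyc:
  assumes "0 < n" "k dvd n" "\<And>i. p (i mod int k) = p i" "\<And>i. \<not> (p i \<and> p (i + 1))"
  obtains u where "lucas_string n u" "cyc u = p"
proof -
  define u where "u = map (\<lambda>i. p (int i)) [0..<n]"
  have "cyc u i = p i" for i
  proof -
    have "cyc u i = p (i mod int n)"
      using assms(1) by (simp add: cyc_def u_def nat_less_iff)
    also have "\<dots> = p (i mod int n mod int k)"
      by (simp add: assms(3))
    also have "\<dots> = p i"
      using assms(2,3) by (simp add: mod_mod_cancel)
    finally show ?thesis .
  qed
  then show thesis
    using that[of u] assms(1,4) by (simp add: lucas_string_iff_cyc fun_eq_iff u_def)
qed

lemma orbit_size_dvd:
  assumes "0 < n" "k dvd n"
  obtains u where "lucas_string n u"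
    "card (range (\<lambda>c. dihedral 1 c u) \<union> range (\<lambda>c. dihedral (-1) c u)) = k"
proof -
  \<comment> \<open>One 1 in every \<open>k\<close> positions gives least period \<open>k\<close>
    and symmetry under negation. For \<open>k = 1\<close> this would be the forbidden string of all
    ones, so the zero string replaces it.\<close>
  define p where "p i \<longleftrightarrow> k \<noteq> 1 \<and> int k dvd i" for i
  have "\<not> (p i \<and> p (i + 1))" for i
    unfolding p_def by (metis dvd_add_right_iff int_dvd_int_iff nat_dvd_1_iff_1 of_nat_1)
  then obtain u where u: "lucas_string n u" "cyc u = p"
    using ex_lucas_string_cyc[OF assms, of p] by (auto simp: p_def dvd_mod_iff)
  have len: "length u = n"
    using u(1) by (simp add: lucas_string_def)
  obtain d where d: "\<And>a. (\<forall>i. p (i + a) = p i) \<longleftrightarrow> int d dvd a"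
    "card (range (\<lambda>c. dihedral 1 c u) \<union> range (\<lambda>c. dihedral (-1) c u)) =
      (if \<exists>c. \<forall>i. p (c - i) = p i then d else 2 * d)"
    by (rule card_dihedral_orbit[OF assms(1) len, unfolded u(2)]) (rule that)
  have "p (0 - i) = p i" for i
    by (simp add: p_def)
  have "(\<forall>i. p (i + a) = p i) \<longleftrightarrow> int k dvd a" for a
  proof
    assume "\<forall>i. p (i + a) = p i"
    then have "p (0 + a) = p 0" ..
    then show "int k dvd a"
      by (auto simp: p_def)
  qed (auto simp: p_def dvd_add_left_iff)
  then have "d = k"
    using d(1) by (metis dvd_antisym dvd_refl int_dvd_int_iff)
  moreover have "\<exists>c. \<forall>i. p (c - i) = p i"
    using \<open>\<And>i. p (0 - i) = p i\<close> by blast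
  ultimately show thesis
    using that[OF u(1)] d(2) by (simp only: if_True)
qed

text \<open>The witness has its ones at the residues 0, 2, 5 modulo \<open>k\<close>: the gaps 2, 3, \<open>k - 5\<close> are
  pairwise distinct as soon as \<open>k \<ge> 9\<close>, which excludes every reflection.\<close>

lemma orbit_size_double:
  assumes "0 < n" "k dvd n" "9 \<le> k"
  obtains u where "lucas_string n u"
    "card (range (\<lambda>c. dihedral 1 c u) \<union> range (\<lambda>c. dihedral (-1) c u)) = 2 * k"
proof -
  define p where "p i \<longleftrightarrow> int k dvd i \<or> int k dvd i - 2 \<or> int k dvd i - 5" for i
  \<comment> \<open>Distinct multiples of \<open>k\<close> are at least 9 apart, which reduces every
    later case to comparing small constants.\<close>
  have near: False if "int k dvd x" "int k dvd y" "x \<noteq> y" "\<bar>x - y\<bar> < 9" for x y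
    using that assms(3) dvd_imp_le_int[of "x - y" "int k"] by (auto simp: dvd_diff)
  have "\<not> (p i \<and> p (i + 1))" for i
  proof
    assume "p i \<and> p (i + 1)"
    then obtain x y :: int where "x \<in> {0, 2, 5}" "y \<in> {0, 2, 5}" "int k dvd i - x" "int k dvd i + 1 - y"
      unfolding p_def by (metis diff_zero insertI1 insertI2)
    then show False
      using near[of "i - x" "i + 1 - y"] by auto
  qed
  moreover have "p (i mod int k) = p i" for i
    unfolding p_def by (simp add: dvd_eq_mod_eq_0 mod_diff_left_eq)
  ultimately obtain u where u: "lucas_string n u" "cyc u = p"
    using ex_lucas_string_cyc[OF assms(1,2), of p] by blast
  have len: "length u = n"
    using u(1) by (simp add: lucas_string_def)
  obtain d where d: "\<And>a. (\<forall>i. p (i + a) = p i) \<longleftrightarrow> int d dvd a"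
    "card (range (\<lambda>c. dihedral 1 c u) \<union> range (\<lambda>c. dihedral (-1) c u)) =
      (if \<exists>c. \<forall>i. p (c - i) = p i then d else 2 * d)"
    by (rule card_dihedral_orbit[OF assms(1) len, unfolded u(2)]) (rule that)
  have p: "p 0" "p 2" "p 5"
    by (simp_all add: p_def)
  have "\<not> (\<forall>i. p (c - i) = p i)" for c
  proof
    assume "\<forall>i. p (c - i) = p i"
    then have "p (c - 0)" "p (c - 2)" "p (c - 5)"
      using p by blast+
    \<comment> \<open>The residue of \<open>c\<close> must be 0, 2 or 5, and then one of
      \<open>c - 2\<close>, \<open>c - 5\<close> misses the pattern. The largest distance compared
      is 8, between \<open>c - 2\<close> and \<open>c - 10\<close>, which is where
      \<open>9 \<le> k\<close> is tight.\<close>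
    then consider "int k dvd c" | "int k dvd c - 2" | "int k dvd c - 5"
      by (auto simp: p_def)
    then show False
    proof cases
      case 1
      then show False
        using \<open>p (c - 2)\<close> near[OF 1, of "c - 2"] near[OF 1, of "c - 4"] near[OF 1, of "c - 7"]
        by (auto simp: p_def)
    next
      case 2
      then show False
        using \<open>p (c - 5)\<close> near[OF 2, of "c - 5"] near[OF 2, of "c - 7"] near[OF 2, of "c - 10"]
        by (auto simp: p_def)
    next
      case 3
      then show False
        using \<open>p (c - 2)\<close> near[OF 3, of "c - 2"] near[OF 3, of "c - 4"] near[OF 3, of "c - 7"]
        by (auto simp: p_def)
    qed
  qed
  have "(\<forall>i. p (i + a) = p i) \<longleftrightarrow> int k dvd a" for a
  proof
    assume "\<forall>i. p (i + a) = p i"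
    then have "p (0 + a)" "p (2 + a)"
      using p by blast+
    \<comment> \<open>Shifts by residue 2 or 5 would move the 1 at position 2 to residue 4 or 7,
      where the pattern has no 1.\<close>
    then consider "int k dvd a" | "int k dvd a - 2" | "int k dvd a - 5"
      by (auto simp: p_def)
    then show "int k dvd a"
    proof cases
      case 2
      then show ?thesis
        using \<open>p (2 + a)\<close> near[OF 2, of "2 + a"] near[OF 2, of a] near[OF 2, of "a - 3"]
        by (auto simp: p_def)
    next
      case 3
      then show ?thesis
        using \<open>p (2 + a)\<close> near[OF 3, of "2 + a"] near[OF 3, of a] near[OF 3, of "a - 3"]
        by (auto simp: p_def)
    qed
  next
    assume a: "int k dvd a"
    show "\<forall>i. p (i + a) = p i"
      using dvd_add_left_iff[OF a] unfolding p_def by (metis add_diff_eq add.commute diff_add_eq)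
  qed
  then have "d = k"
    using d(1) by (metis dvd_antisym dvd_refl int_dvd_int_iff)
  moreover have "\<not> (\<exists>c. \<forall>i. p (c - i) = p i)"
    using \<open>\<And>c. \<not> (\<forall>i. p (c - i) = p i)\<close> by blast
  ultimately show thesis
    using that[OF u(1)] d(2) by (simp only: if_False)
qed

section \<open>Reflection symmetry for periods up to 8\<close>

text \<open>An exhaustive evaluation over the 510 binary words of lengths 1 to 8, phrased with
  executable list functions for that purpose.\<close>

lemma cyclic_words_le_8_reflection:
  "list_all (\<lambda>d. list_all
     (\<lambda>w. list_ex (\<lambda>i. w ! i \<and> w ! (Suc i mod d)) [0..<d] \<or> list_ex (\<lambda>c. rotate c w = rev w) [0..<d])
     (List.n_lists d [True, False])) [1, 2, 3, 4, 5, 6, 7, 8]"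
  by code_simp

lemma short_lucas_string_reflection:
  assumes "0 < d" "d \<le> 8" "lucas_string d w"
  obtains c where "\<And>i. cyc w (c - i) = cyc w i"
proof -
  have len: "length w = d" and "ones w \<in> cycle_indep d"
    using assms lucas_string_iff_ones by auto
  then have "\<not> (w ! i \<and> w ! (Suc i mod d))" if "i < d" for i
    using that assms(1) by (auto simp: cycle_indep_def ones_def)
  moreover have "d \<in> set [1, 2, 3, 4, 5, 6, 7, 8]"
    using assms(1,2) by auto
  moreover have "w \<in> set (List.n_lists d [True, False])"
    using len by (auto simp: set_n_lists)
  ultimately obtain c where "rotate c w = rev w"
    using cyclic_words_le_8_reflection unfolding list_all_iff list_ex_iff by fastforce
  moreover have "rotate c w = dihedral 1 (int c) w"
    using len by (intro nth_equalityI) (simp_all add: nth_rotate dihedral_def cyc_def nat_mod_as_int add.commute)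
  \<comment> \<open>Reversal sends index \<open>i\<close> to \<open>d - 1 - i\<close>, so equality
    of a rotation with the reversal is a reflection symmetry, centred after a shift by
    \<open>c\<close>.\<close>
  moreover have "rev w = dihedral (-1) (int d - 1) w"
    using len by (intro nth_equalityI) (simp_all add: rev_nth dihedral_def cyc_def nat_diff_distrib)
  ultimately have "\<forall>i. cyc w (i + int c) = cyc w (int d - 1 - i)"
    using dihedral_eq_iff[of w w 1 "int c" "-1" "int d - 1"] len assms(1) by simp
  then have refl: "cyc w ((i - int c) + int c) = cyc w (int d - 1 - (i - int c))" for i
    by blast
  have "cyc w (int d - 1 + int c - i) = cyc w i" for i
    using refl[of i] by (simp add: algebra_simps)
  then show thesis
    by (rule that)
qed

text \<open>A single period of \<open>u\<close>, closed up cyclically, is a Lucas string of length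
  \<open>d\<close> with the same \<open>cyc\<close>, so its reflection symmetry passes to
  \<open>u\<close>.\<close>

lemma short_period_reflection:
  assumes "0 < n" "lucas_string n u" "0 < d" "d \<le> 8"
    and period: "\<And>i a. int d dvd a \<Longrightarrow> cyc u (i + a) = cyc u i"
  obtains c where "\<And>i. cyc u (c - i) = cyc u i"
proof -
  have "cyc u (i mod int d) = cyc u i" for i
    using period[of "int d * (i div int d)" "i mod int d"] by (simp only: mod_mult_div_eq dvd_triv_left)
  moreover have "\<not> (cyc u i \<and> cyc u (i + 1))" for i
    using assms(1,2) lucas_string_iff_cyc by blast
  ultimately obtain w where "lucas_string d w" "cyc w = cyc u"
    using ex_lucas_string_cyc[OF assms(3) dvd_refl, of "cyc u"] by blast
  then show thesis
    using short_lucas_string_reflection[OF assms(3,4)] that by metis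
qed

theorem theorem5p2:
  fixes n :: nat
  assumes "0 < n"
  shows "{card X | X. X \<in> vertex_orbits (lucas_cube n)} =
    {k. k \<ge> 1 \<and> k dvd n} \<union> {k. k \<ge> 18 \<and> k dvd 2 * n}"
proof -
  define orbit_size where
    "orbit_size u = card (range (\<lambda>c. dihedral 1 c u) \<union> range (\<lambda>c. dihedral (-1) c u))" for u :: "bool list"
  have sizes: "{card X | X. X \<in> vertex_orbits (lucas_cube n)} = {orbit_size u | u. lucas_string n u}"
    unfolding vertex_orbits_lucas_cube[OF assms] orbit_size_def by blast
  have "k dvd n \<and> 1 \<le> k \<or> 18 \<le> k \<and> k dvd 2 * n" if u: "lucas_string n u" and k: "k = orbit_size u" for u k
  proof -
    have len: "length u = n"
      using u by (simp add: lucas_string_def)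
    obtain d where d: "0 < d" "d dvd n"
      "\<And>a. (\<forall>i. cyc u (i + a) = cyc u i) \<longleftrightarrow> int d dvd a"
      "orbit_size u = (if \<exists>c. \<forall>i. cyc u (c - i) = cyc u i then d else 2 * d)"
      by (rule card_dihedral_orbit[OF assms len, folded orbit_size_def]) (rule that)
    show ?thesis
    proof (cases "\<exists>c. \<forall>i. cyc u (c - i) = cyc u i")
      case True
      then show ?thesis
        using d(1,2,4) k by auto
    next
      case False
      \<comment> \<open>Without a reflection symmetry the period is at least 9, so the orbit size
        \<open>2 * d\<close> is at least 18.\<close>
      have "\<not> d \<le> 8"
      proof
        assume "d \<le> 8"
        have "cyc u (i + a) = cyc u i" if "int d dvd a" for i a
          using d(3) that by blast
        then obtain c where "\<And>i. cyc u (c - i) = cyc u i"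
          using short_period_reflection[OF assms u d(1) \<open>d \<le> 8\<close>] by blast
        then show False
          using False by blast
      qed
      moreover have "k = 2 * d"
        using d(4) k unfolding if_not_P[OF False] by simp
      ultimately show ?thesis
        using d(2) by auto
    qed
  qed
  moreover have "\<exists>u. lucas_string n u \<and> orbit_size u = k" if "k dvd n" for k
    by (rule orbit_size_dvd[OF assms that, folded orbit_size_def]) blast
  moreover have "\<exists>u. lucas_string n u \<and> orbit_size u = k" if "18 \<le> k" "k dvd 2 * n" for k
  \<comment> \<open>An even \<open>k\<close> is twice a divisor of \<open>n\<close> that is at least
    9 and comes from a string without reflection symmetry; an odd \<open>k\<close> dividing
    \<open>2 * n\<close> already divides \<open>n\<close>.\<close>
  proof (cases "even k")
    case True
    then obtain m where "k = 2 * m" ..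
    then have "m dvd n" "9 \<le> m"
      using that by simp_all
    then show ?thesis
      unfolding \<open>k = 2 * m\<close> by (rule orbit_size_double[OF assms, folded orbit_size_def]) blast
  next
    case False
    then have "k dvd n"
      using that(2) by (simp add: coprime_dvd_mult_right_iff)
    then show ?thesis
      by (rule orbit_size_dvd[OF assms, folded orbit_size_def]) blast
  qed
  ultimately have "{orbit_size u | u. lucas_string n u} =
      {k. k \<ge> 1 \<and> k dvd n} \<union> {k. k \<ge> 18 \<and> k dvd 2 * n}"
    by blast
  then show ?thesis
    unfolding sizes .
qed

end
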